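(* Let $f:\mathbb R^n\to\mathbb R$ be continuously differentiable, $A\in\mathbb R^{m\times n}$ with $m\le n$, $\mathbf b\in\mathbb R^m$, and let $s<m$ be a positive integer. Consider the problem $$(\mathrm P)\qquad \min_{\mathbf x\in\mathbb R^n} f(\mathbf x)\quad\text{s.t.}\quad \|(A\mathbf x-\mathbf b)_+\|_0\le s.$$ For $\mathbf x^*\in\mathbb R^n$ let $J_*=\{i\in\{1,\dots,m\}:(A\mathbf x^*-\mathbf b)_i=0\}$. a) Let $\mathbf x^*$ be a local minimizer of $(\mathrm P)$ such that $A_{J_*}$ has full row rank. If $\|(A\mathbf x^*-\mathbf b)_+\|_0<s$, then $\mathbf x^*$ is a $\tau$-stationary point of $(\mathrm P)$ for any $\tau>0$. If $\|(A\mathbf x^*-\mathbf b)_+\|_0=s$, then $\mathbf x^*$ is a $\tau$-stationary point of $(\mathrm P)$ for any $0<\tau\le\tau_*$ (any $\tau>0$ if $\tau_*=+\infty$), where $$\tau_*:=\frac{(A\mathbf x^*-\mathbf b)_{[s]}}{\max_{i}\big|(\Pi\nabla f(\mathbf x^* ))_i\big|}>0,\qquad \Pi:=(A_{J_*}A_{J_*}^\top)^{-1}A_{J_*},$$ the maximum being over all entries of the vector $\Pi\nabla f(\mathbf x^* )\in\mathbb R^{|J_*|}$, with $\tau_*:=+\infty$ if $\Pi\nabla f(\mathbf x^* )=0$ or $J_*=\emptyset$. b) Suppose $f$ is convex and $\mathbf x^*$ is a $\tau$-stationary point of $(\mathrm P)$ for some $\tau>0$. Then $\mathbf x^*$ is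 a local minimizer of $(\mathrm P)$ if $\|(A\mathbf x^*-\mathbf b)_+\|_0=s$, and a global minimizer of $(\mathrm P)$ if $\|(A\mathbf x^*-\mathbf b)_+\|_0<s$. c) Suppose $f$ is strongly convex with constant $M_f>0$. If $\mathbf x^*$ is a $\tau$-stationary point of $(\mathrm P)$ with $\tau>0$ and $\tau\ge\|A\|^2/M_f$, then $\mathbf x^*$ is a global minimizer of $(\mathrm P)$.
   Context: For $\mathbf u\in\mathbb R^m$, $\mathbf u_+$ is the entrywise positive part $\max\{u_i,0\}$, $\|\cdot\|_0$ counts nonzero entries, and $u_{[s]}$ is the $s$th largest element of $\mathbf u_+$ (zero when $\|\mathbf u_+\|_0<s$, positive otherwise). $A_J$ is the submatrix of rows of $A$ indexed by $J$. For vectors $\|\cdot\|$ is the Euclidean norm and for matrices the spectral norm. Let $S=\{\mathbf u\in\mathbb R^m:\|\mathbf u_+\|_0\le s\}$ and $\mathbb P_S(\mathbf z)=\operatorname{argmin}\{\|\mathbf z-\mathbf u\|:\mathbf u\in S\}$ (the set of all minimizers). A point $\mathbf x^*\in\mathbb R^n$ is a $\tau$-stationary point of $(\mathrm P)$, for $\tau>0$, if there is $\boldsymbol\lambda^*\in\mathbb R^m$ such that $\nabla f(\mathbf x^* )+A^\top\boldsymbol\lambda^*=0$ and $A\mathbf x^*-\mathbf b\in\mathbb P_S(A\mathbf x^*-\mathbf b+\tau\boldsymbol\lambda^* )$. $f$ is strongly convex with constant $M_f>0$ if $f(\mathbf x)\ge f(\mathbf x')+\langle\nabla f(\mathbf x'),\mathbf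 x-\mathbf x'\rangle+(M_f/2)\|\mathbf x-\mathbf x'\|^2$ for all $\mathbf x,\mathbf x'\in\mathbb R^n$. *)

theory Defs
  imports "HOL-Analysis.Analysis" "HOL-Library.Multiset" "HOL-Library.Extended_Real"
begin

definition gradient :: "(real^'n \<Rightarrow> real) \<Rightarrow> real^'n \<Rightarrow> real^'n" where
  "gradient f x = (THE D. GDERIV f x :> D)"

lemma gradient_eqI:
  assumes "GDERIV f x :> D"
  shows "gradient f x = D"
  unfolding gradient_def
proof (rule the_equality)
  fix D' assume "GDERIV f x :> D'"
  then have "(\<lambda>h. h \<bullet> D') = (\<lambda>h. h \<bullet> D)"
    using assms has_derivative_unique unfolding gderiv_def by blast
  then have "\<And>h. h \<bullet> D' = h \<bullet> D"
    by (rule fun_cong)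
  then show "D' = D"
    using vector_eq_rdot[of D' D] by (simp add: inner_commute)
qed (rule assms)

definition strongly_convex :: "real \<Rightarrow> (real^'n \<Rightarrow> real) \<Rightarrow> bool" where
  "strongly_convex M f \<longleftrightarrow> 0 < M \<and>
     (\<forall>x x'. f x \<ge> f x' + gradient f x' \<bullet> (x - x') + M / 2 * (norm (x - x'))\<^sup>2)"

definition vpos :: "real^'m \<Rightarrow> real^'m" where
  "vpos u = (\<chi> i. max (u $ i) 0)"

definition l0 :: "real^'m \<Rightarrow> nat" where
  "l0 u = card {i. u $ i \<noteq> 0}"

(* Entries are counted with multiplicity; meaningful for 1 \<le> s \<le> CARD('m). *)
definition sth_largest_pos :: "nat \<Rightarrow> real^'m \<Rightarrow> real" where
  "sth_largest_pos s u =
     rev (sorted_list_of_multiset (image_mset (\<lambda>i. vpos u $ i) (mset_set UNIV))) ! (s - 1)"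

definition sparse_set :: "nat \<Rightarrow> (real^'m) set" where
  "sparse_set s = {u. l0 (vpos u) \<le> s}"

definition proj_set :: "(real^'m) set \<Rightarrow> real^'m \<Rightarrow> (real^'m) set" where
  "proj_set S z = {u. is_arg_min (\<lambda>u. norm (z - u)) (\<lambda>u. u \<in> S) u}"

definition feasible :: "real^'n^'m \<Rightarrow> real^'m \<Rightarrow> nat \<Rightarrow> (real^'n) set" where
  "feasible A b s = {x. l0 (vpos (A *v x - b)) \<le> s}"

definition global_minimizer :: "('a \<Rightarrow> real) \<Rightarrow> 'a set \<Rightarrow> 'a \<Rightarrow> bool" where
  "global_minimizer f F x \<longleftrightarrow> x \<in> F \<and> (\<forall>y\<in>F. f x \<le> f y)"

definition local_minimizer :: "('a::metric_space \<Rightarrow> real) \<Rightarrow> 'a set \<Rightarrow> 'a \<Rightarrow> bool" where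
  "local_minimizer f F x \<longleftrightarrow> x \<in> F \<and> (\<exists>e>0. \<forall>y\<in>F \<inter> ball x e. f x \<le> f y)"

definition tau_stationary ::
    "(real^'n \<Rightarrow> real) \<Rightarrow> real^'n^'m \<Rightarrow> real^'m \<Rightarrow> nat \<Rightarrow> real \<Rightarrow> real^'n \<Rightarrow> bool" where
  "tau_stationary f A b s \<tau> x \<longleftrightarrow> 0 < \<tau> \<and>
     (\<exists>l. gradient f x + transpose A *v l = 0 \<and>
          A *v x - b \<in> proj_set (sparse_set s) (A *v x - b + \<tau> *\<^sub>R l))"

definition active_set :: "real^'n^'m \<Rightarrow> real^'m \<Rightarrow> real^'n \<Rightarrow> 'm set" where
  "active_set A b x = {i. (A *v x - b) $ i = 0}"

(* A matrix whose row (or column) indices range over a subset J of 'm is represented by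
   its extension by zero to all of 'm. Products of such matrices, and the rank, agree with those
   of the matrices actually indexed by J. *)
definition row_submatrix :: "real^'n^'m \<Rightarrow> 'm set \<Rightarrow> real^'n^'m" where
  "row_submatrix A J = (\<chi> i j. if i \<in> J then A $ i $ j else 0)"

definition full_row_rank_on :: "'m set \<Rightarrow> real^'n^'m \<Rightarrow> bool" where
  "full_row_rank_on J A \<longleftrightarrow> rank (row_submatrix A J) = card J"

definition mat_one_on :: "'m set \<Rightarrow> real^'m^'m" where
  "mat_one_on J = (\<chi> i j. if i \<in> J \<and> i = j then 1 else 0)"

(* The inverse of a J \<times> J matrix, extended by zero; unspecified if M is singular
   on J. The library's matrix_inv does not apply, as the extension by zero is singular on 'm. *)
definition mat_inverse_on :: "'m set \<Rightarrow> real^'m^'m \<Rightarrow> real^'m^'m" where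
  "mat_inverse_on J M = (THE N. (\<forall>i j. i \<notin> J \<or> j \<notin> J \<longrightarrow> N $ i $ j = 0) \<and>
     M ** N = mat_one_on J \<and> N ** M = mat_one_on J)"

definition Pi_mat :: "real^'n^'m \<Rightarrow> 'm set \<Rightarrow> real^'n^'m" where
  "Pi_mat A J =
     mat_inverse_on J (row_submatrix A J ** transpose (row_submatrix A J)) ** row_submatrix A J"

(* Only the entries of the vector with index in J are entries of the original one; the condition
   of the first case holds in particular for empty J. *)
definition tau_star ::
    "(real^'n \<Rightarrow> real) \<Rightarrow> real^'n^'m \<Rightarrow> real^'m \<Rightarrow> nat \<Rightarrow> real^'n \<Rightarrow> ereal" where
  "tau_star f A b s x =
     (let J = active_set A b x; v = Pi_mat A J *v gradient f x in
      if \<forall>i\<in>J. v $ i = 0 then \<infinity>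
      else ereal (sth_largest_pos s (A *v x - b) / Max ((\<lambda>i. \<bar>v $ i\<bar>) ` J)))"

(* The operator norm induced by the Euclidean norms. *)
definition spectral_norm :: "real^'n^'m \<Rightarrow> real" where
  "spectral_norm A = onorm ((*v) A)"

end

theory Submission
  imports Defs
begin

text \<open>
  Write \<open>y = A x - b\<close> and let \<open>S\<close> be the set of vectors with at most \<open>s\<close> positive entries. Expanding
  squares turns \<open>y \<in> P_S(y + \<tau> \<lambda>)\<close> into the inequality
  \<open>2 \<tau> \<langle>\<lambda>, u - y\<rangle> \<le> \<parallel>u - y\<parallel>\<^sup>2\<close> for all \<open>u \<in> S\<close> (\<open>proj_set_iff\<close>), and the multiplier equation turns
  \<open>\<langle>\<nabla>f x, z - x\<rangle>\<close> into \<open>- \<langle>\<lambda>, (A z - b) - y\<rangle>\<close>. Both sufficiency statements follow from these two facts.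

  In the strongly convex case the inequality bounds the first-order decrease at a feasible \<open>z\<close> by
  \<open>\<parallel>A (z - x)\<parallel>\<^sup>2 / (2 \<tau>)\<close>, and \<open>\<tau> \<ge> \<parallel>A\<parallel>\<^sup>2 / M\<close> says that the quadratic growth of \<open>f\<close> makes up for it.
  In the convex case the quadratic right-hand side is removed by shrinking \<open>u - y\<close>: whenever the
  whole segment from \<open>y\<close> to \<open>u\<close> lies in \<open>S\<close>, the left-hand side must be at most \<open>0\<close>
  (\<open>inner_nonpos_of_proj_set\<close>). If \<open>y\<close> has exactly \<open>s\<close> positive entries, then \<open>S\<close> is star-shaped about
  \<open>y\<close> near \<open>y\<close>, which gives local minimality; if it has fewer, then \<open>S\<close> contains the lines
  through \<open>y\<close> in all coordinate directions, so that \<open>\<lambda> = 0\<close> and \<open>x\<close> is a critical point.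

  For necessity, let \<open>B\<close> consist of the rows of \<open>A\<close> that are active at \<open>x\<close>. Full row rank makes
  \<open>B B\<^sup>T\<close> invertible on the active indices, so \<open>B d\<close> can be prescribed. A direction with \<open>B d = 0\<close> is
  feasible, whence \<open>\<nabla>f x = B\<^sup>T v\<close> with \<open>v = \<Pi> \<nabla>f x\<close>; directions with \<open>B d = - e\<^sub>i\<close> are feasible, whence \<open>v \<le> 0\<close>;
  and if there is room for one more positive entry, \<open>B d = e\<^sub>i\<close> is feasible too, whence \<open>v = 0\<close>
  (\<open>local_minimizer_multiplier\<close>). With \<open>\<lambda> = - v\<close> it remains to see that \<open>y\<close> is a projection of
  \<open>y + \<tau> \<lambda>\<close>. A point of \<open>S\<close> closer to \<open>y + \<tau> \<lambda>\<close> would have to match some of the entries \<open>\<tau> \<lambda>\<^sub>i\<close>, and pay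
  for each with one of the \<open>s\<close> positive entries of \<open>y\<close>; this is no gain, because \<open>\<tau> \<le> \<tau>\<^sub>*\<close> means that no
  \<open>\<tau> \<lambda>\<^sub>i\<close> exceeds the smallest of these
  (\<open>proj_set_sparse_setI\<close>).
\<close>

section \<open>First-order conditions for differentiable functions\<close>

lemma gderiv_gradient:
  fixes f :: "real^'n \<Rightarrow> real"
  assumes "f differentiable (at x)"
  shows "GDERIV f x :> gradient f x"
proof -
  obtain f' where f': "(f has_derivative f') (at x)"
    using assms unfolding differentiable_def by blast
  then have lin: "linear f'"
    by (rule has_derivative_linear)
  define D where "D = (\<Sum>i\<in>Basis. f' i *\<^sub>R i)"
  have "f' = (\<lambda>h. h \<bullet> D)"
  proof
    fix h
    have "f' h = f' (\<Sum>i\<in>Basis. (h \<bullet> i) *\<^sub>R i)"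
      by (simp add: euclidean_representation)
    also have "\<dots> = h \<bullet> D"
      by (simp add: linear_sum[OF lin] linear_scale[OF lin] D_def inner_sum_right mult.commute)
    finally show "f' h = h \<bullet> D" .
  qed
  with f' have "GDERIV f x :> D"
    by (simp add: gderiv_def)
  then show ?thesis
    using gradient_eqI by blast
qed

lemma DERIV_along_line:
  fixes f :: "real^'n \<Rightarrow> real"
  assumes "f differentiable (at x)"
  shows "DERIV (\<lambda>t. f (x + t *\<^sub>R d)) 0 :> gradient f x \<bullet> d"
proof -
  have "(f has_derivative (\<lambda>h. h \<bullet> gradient f x)) (at (x + 0 *\<^sub>R d))"
    using gderiv_gradient[OF assms] by (simp add: gderiv_def)
  moreover have "((\<lambda>t. x + t *\<^sub>R d) has_derivative (\<lambda>t. t *\<^sub>R d)) (at 0)"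
    by (auto intro!: derivative_eq_intros)
  ultimately have "((\<lambda>t. f (x + t *\<^sub>R d)) has_derivative
      (\<lambda>t. (t *\<^sub>R d) \<bullet> gradient f x)) (at 0)"
    using has_derivative_compose by blast
  then show ?thesis
    by (simp add: has_field_derivative_def inner_commute mult_commute_abs)
qed

text \<open>Along a direction of negative slope, \<open>f\<close> would decrease inside the feasible set.\<close>

lemma gradient_nonneg_of_local_minimizer:
  fixes f :: "real^'n \<Rightarrow> real"
  assumes diff: "f differentiable (at x)"
    and min: "local_minimizer f F x"
    and feas: "eventually (\<lambda>t. x + t *\<^sub>R d \<in> F) (at_right 0)"
  shows "0 \<le> gradient f x \<bullet> d"
proof (rule ccontr)
  assume "\<not> 0 \<le> gradient f x \<bullet> d"
  then obtain \<delta> where \<delta>: "\<delta> > 0" "\<And>h. 0 < h \<Longrightarrow> h < \<delta> \<Longrightarrow> f x > f (x + h *\<^sub>R d)"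
    using DERIV_neg_dec_right[OF DERIV_along_line[OF diff, of d]] by auto
  obtain e where e: "e > 0" "\<And>y. y \<in> F \<Longrightarrow> y \<in> ball x e \<Longrightarrow> f x \<le> f y"
    using min unfolding local_minimizer_def by auto
  have "((\<lambda>t. x + t *\<^sub>R d) \<longlongrightarrow> x + 0 *\<^sub>R d) (at_right 0)"
    by (intro tendsto_intros)
  then have "eventually (\<lambda>t. x + t *\<^sub>R d \<in> ball x e) (at_right 0)"
    using e(1) by (intro topological_tendstoD) auto
  moreover have "eventually (\<lambda>t. t \<in> {0<..<\<delta>}) (at_right 0)"
    using \<delta>(1) by (rule eventually_at_right_real)
  ultimately have "eventually (\<lambda>t. False) (at_right (0::real))"
    using feas
  proof eventually_elim
    case (elim t)
    then show False
      using \<delta>(2)[of t] e(2)[of "x + t *\<^sub>R d"] by auto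
  qed
  then show False
    by simp
qed

text \<open>
  If the tangent inequality failed at \<open>y\<close>, the difference between the chord and \<open>f\<close> on the segment
  from \<open>x\<close> to \<open>y\<close> would have negative slope at \<open>x\<close>, and the graph would rise above the chord.
\<close>

lemma convex_on_above_tangent:
  fixes f :: "real^'n \<Rightarrow> real"
  assumes diff: "f differentiable (at x)" and conv: "convex_on UNIV f"
  shows "f x + gradient f x \<bullet> (y - x) \<le> f y"
proof (rule ccontr)
  assume less: "\<not> ?thesis"
  let ?\<phi> = "\<lambda>t. t * (f y - f x) - f (x + t *\<^sub>R (y - x))"
  have "DERIV ?\<phi> 0 :> (f y - f x) - gradient f x \<bullet> (y - x)"
    by (auto intro!: derivative_eq_intros DERIV_along_line[OF diff])
  moreover have "(f y - f x) - gradient f x \<bullet> (y - x) < 0"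
    using less by simp
  ultimately have "\<exists>\<delta>>0. \<forall>h>0. h < \<delta> \<longrightarrow> ?\<phi> 0 > ?\<phi> (0 + h)"
    by (rule DERIV_neg_dec_right)
  then obtain \<delta> where \<delta>: "\<delta> > 0" "\<And>h. 0 < h \<Longrightarrow> h < \<delta> \<Longrightarrow> ?\<phi> 0 > ?\<phi> h"
    by (auto simp only: add_0)
  define t where "t = min (\<delta> / 2) 1"
  have t: "0 < t" "t < \<delta>" "t \<le> 1"
    using \<delta>(1) by (auto simp: t_def)
  have "f ((1 - t) *\<^sub>R x + t *\<^sub>R y) \<le> (1 - t) * f x + t * f y"
    using convex_onD[OF conv, of t x y] t by simp
  moreover have "(1 - t) *\<^sub>R x + t *\<^sub>R y = x + t *\<^sub>R (y - x)"
    by (simp add: algebra_simps)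
  ultimately show False
    using \<delta>(2)[OF t(1,2)] by (simp add: algebra_simps)
qed

section \<open>Projections onto the sparse set\<close>

lemma l0_vpos: "l0 (vpos u) = card {i. 0 < u $ i}"
proof -
  have "{i. vpos u $ i \<noteq> 0} = {i. 0 < u $ i}"
    by (auto simp: vpos_def max_def)
  then show ?thesis
    by (simp add: l0_def)
qed

lemma sparse_setI:
  assumes "{i. 0 < u $ i} \<subseteq> K" "card K \<le> s"
  shows "u \<in> sparse_set s"
  using card_mono[OF finite assms(1)] assms(2) by (simp add: sparse_set_def l0_vpos)

lemma feasible_iff: "x \<in> feasible A b s \<longleftrightarrow> A *v x - b \<in> sparse_set s"
  by (simp add: feasible_def sparse_set_def)

text \<open>
  The distance condition with its squares expanded: the variational inequality that is used
  for projections from here on, valid for an arbitrary set \<open>S\<close>.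
\<close>

lemma proj_set_iff:
  "y \<in> proj_set S (y + w) \<longleftrightarrow> y \<in> S \<and> (\<forall>u\<in>S. 2 * (w \<bullet> (u - y)) \<le> (norm (u - y))\<^sup>2)"
proof -
  have "norm (y + w - y) \<le> norm (y + w - u) \<longleftrightarrow> 2 * (w \<bullet> (u - y)) \<le> (norm (u - y))\<^sup>2" for u
  proof -
    have "norm (y + w - y) \<le> norm (y + w - u) \<longleftrightarrow> (norm w)\<^sup>2 \<le> (norm (w - (u - y)))\<^sup>2"
      by (simp add: algebra_simps)
    also have "(norm (w - (u - y)))\<^sup>2 = (norm w)\<^sup>2 - 2 * (w \<bullet> (u - y)) + (norm (u - y))\<^sup>2"
      by (simp add: power2_norm_eq_inner inner_diff_left inner_diff_right inner_commute)
    finally show ?thesis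
      by simp
  qed
  then show ?thesis
    by (auto simp: proj_set_def is_arg_min_linorder)
qed

text \<open>
  Exchange argument. Compared with \<open>y\<close>, a competitor \<open>u\<close> saves at most \<open>\<theta>\<^sup>2\<close> for every index where it
  is positive and \<open>y\<close> is not, and pays at least \<open>\<theta>\<^sup>2\<close> for every index where \<open>y\<close> is positive and
  it is not. As \<open>y\<close> has the maximal number of positive entries, there are at least as many
  payments as savings.
\<close>

lemma proj_set_sparse_setI:
  assumes s: "card {i. 0 < y $ i} = s"
    and \<theta>: "0 \<le> \<theta>" "\<And>i. 0 < y $ i \<Longrightarrow> \<theta> \<le> y $ i"
    and w: "\<And>i. y $ i \<noteq> 0 \<Longrightarrow> w $ i = 0" "\<And>i. 0 \<le> w $ i" "\<And>i. w $ i \<le> \<theta>"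
  shows "y \<in> proj_set (sparse_set s) (y + w)"
proof -
  have "2 * (w \<bullet> (u - y)) \<le> (norm (u - y))\<^sup>2" if u: "u \<in> sparse_set s" for u
  proof -
    let ?K = "{i. 0 < y $ i}" and ?P = "{i. 0 < u $ i}"
    have "card ?P \<le> card ?K"
      using u s by (simp add: sparse_set_def l0_vpos)
    then have card: "card (?P - ?K) \<le> card (?K - ?P)"
      by (metis card_le_sym_Diff finite)
    \<comment> \<open>\<open>u $ i - y $ i\<close> squared minus the cross term is the change of the squared distance in
      coordinate \<open>i\<close>.\<close>
    have pt: "\<theta>\<^sup>2 * (of_bool (i \<in> ?K - ?P) - of_bool (i \<in> ?P - ?K)) \<le>
        (u $ i - y $ i)\<^sup>2 - 2 * (w $ i * (u $ i - y $ i))" for i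
    proof -
      have wsq: "(w $ i)\<^sup>2 \<le> \<theta>\<^sup>2"
        using w(2,3) by (rule power_mono[rotated])
      consider "0 < y $ i" "0 < u $ i" | "0 < y $ i" "u $ i \<le> 0" | "y $ i = 0" "0 < u $ i"
        | "y $ i = 0" "u $ i \<le> 0" | "y $ i < 0"
        by linarith
      then show ?thesis
      proof cases
        case 2
        then have "\<theta>\<^sup>2 \<le> (y $ i - u $ i)\<^sup>2"
          using \<theta>(1) \<theta>(2)[of i] by (intro power_mono) auto
        then show ?thesis
          using 2 w(1)[of i] by (simp add: power2_commute)
      next
        case 3
        have "0 \<le> (u $ i - w $ i)\<^sup>2"
          by simp
        then show ?thesis
          using 3 wsq by (simp add: power2_diff algebra_simps)
      next
        case 4
        then have "w $ i * u $ i \<le> 0"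
          using w(2)[of i] by (simp add: mult_nonneg_nonpos)
        then have "2 * (w $ i * u $ i) \<le> (u $ i)\<^sup>2"
          using zero_le_power2[of "u $ i"] by linarith
        then show ?thesis
          using 4 by simp
      qed (use w(1)[of i] in auto)
    qed
    have "0 \<le> \<theta>\<^sup>2 * (real (card (?K - ?P)) - real (card (?P - ?K)))"
      using card by simp
    also have "\<dots> = (\<Sum>i\<in>UNIV. \<theta>\<^sup>2 * (of_bool (i \<in> ?K - ?P) - of_bool (i \<in> ?P - ?K)))"
      by (simp only: sum_distrib_left[symmetric] sum_subtractf sum_of_bool_eq finite
          Int_UNIV_left Collect_mem_eq)
    also have "\<dots> \<le> (\<Sum>i\<in>UNIV. (u $ i - y $ i)\<^sup>2 - 2 * (w $ i * (u $ i - y $ i)))"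
      using pt by (rule sum_mono)
    also have "\<dots> = (norm (u - y))\<^sup>2 - 2 * (w \<bullet> (u - y))"
      unfolding power2_norm_eq_inner
      by (simp add: inner_vec_def sum_subtractf sum_distrib_left power2_eq_square)
    finally show ?thesis
      by simp
  qed
  then show ?thesis
    using s by (simp add: proj_set_iff sparse_set_def l0_vpos)
qed

text \<open>
  At the point \<open>y + t (u - y)\<close> the two sides of the variational inequality have order \<open>t\<close> and
  \<open>t\<^sup>2\<close>; dividing by \<open>t\<close> and letting it tend to \<open>0\<close> leaves only the left-hand side.
\<close>

lemma inner_nonpos_of_proj_set:
  assumes proj: "y \<in> proj_set S (y + w)"
    and seg: "\<And>t. 0 < t \<Longrightarrow> t \<le> 1 \<Longrightarrow> y + t *\<^sub>R (u - y) \<in> S"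
  shows "w \<bullet> (u - y) \<le> 0"
proof (rule tendsto_lowerbound)
  show "((\<lambda>t::real. t * (norm (u - y))\<^sup>2 / 2) \<longlongrightarrow> 0) (at_right 0)"
    by (auto intro!: tendsto_eq_intros)
  show "eventually (\<lambda>t. w \<bullet> (u - y) \<le> t * (norm (u - y))\<^sup>2 / 2) (at_right 0)"
    using eventually_at_right_real[OF zero_less_one]
  proof eventually_elim
    case (elim t)
    then have "2 * (w \<bullet> (t *\<^sub>R (u - y))) \<le> (norm (t *\<^sub>R (u - y)))\<^sup>2"
      using proj seg[of t] unfolding proj_set_iff
      by (metis add_diff_cancel_left' greaterThanLessThan_iff less_imp_le)
    then have "t * (2 * (w \<bullet> (u - y))) \<le> t * (t * (norm (u - y))\<^sup>2)"
      by (simp only: norm_scaleR power_mult_distrib power2_abs inner_scaleR_right)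
        (simp add: power2_eq_square mult_ac)
    then show ?case
      using elim by simp
  qed
qed simp

text \<open>
  With room for one more positive entry, any single entry of \<open>y\<close> may be changed in either direction
  without leaving the sparse set, so no entry of \<open>w\<close> can have a sign.
\<close>

lemma eq_0_of_proj_set_sparse_set:
  assumes proj: "y \<in> proj_set (sparse_set s) (y + w)" and less: "l0 (vpos y) < s"
  shows "w = 0"
proof -
  have le: "w \<bullet> axis i c \<le> 0" for i c
  proof -
    have "y + t *\<^sub>R (y + axis i c - y) \<in> sparse_set s" for t
    proof (rule sparse_setI)
      show "{j. 0 < (y + t *\<^sub>R (y + axis i c - y)) $ j} \<subseteq> insert i {j. 0 < y $ j}"
        by (auto simp: axis_def)
      show "card (insert i {j. 0 < y $ j}) \<le> s"
        using less by (simp add: l0_vpos card_insert_if)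
    qed
    then show ?thesis
      using inner_nonpos_of_proj_set[OF proj, of "y + axis i c"] by simp
  qed
  have "w $ i = 0" for i
    using le[of i 1] le[of i "- 1"] by (simp add: inner_axis)
  then show ?thesis
    by (simp add: vec_eq_iff)
qed

text \<open>
  Near \<open>y\<close>, the positive entries of \<open>y\<close> stay positive. They already exhaust the budget \<open>s\<close>, so the
  nearby elements of the sparse set have exactly the same positive entries as \<open>y\<close>, and these
  sign conditions are convex.
\<close>

lemma sparse_set_locally_star_shaped:
  assumes y: "l0 (vpos y) = s"
  shows "eventually (\<lambda>u. u \<in> sparse_set s \<longrightarrow>
    (\<forall>t. 0 < t \<longrightarrow> t \<le> 1 \<longrightarrow> y + t *\<^sub>R (u - y) \<in> sparse_set s)) (nhds y)"
proof -
  have "eventually (\<lambda>u. 0 < u $ i) (nhds y)" if "0 < y $ i" for i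
  proof -
    have "((\<lambda>u. u $ i) \<longlongrightarrow> y $ i) (nhds y)"
      by (intro tendsto_intros filterlim_ident)
    then show ?thesis
      using that by (rule order_tendstoD)
  qed
  then have "eventually (\<lambda>u. \<forall>i\<in>{i. 0 < y $ i}. 0 < u $ i) (nhds y)"
    by (intro eventually_ball_finite) auto
  then show ?thesis
  proof eventually_elim
    case (elim u)
    show ?case
    proof (intro impI allI)
      fix t :: real
      assume u: "u \<in> sparse_set s" and t: "0 < t" "t \<le> 1"
      have "{i. 0 < y $ i} = {i. 0 < u $ i}"
        using u y elim by (intro card_seteq) (auto simp: sparse_set_def l0_vpos)
      then have le: "u $ i \<le> 0 \<Longrightarrow> y $ i \<le> 0" for i
        by (auto simp: set_eq_iff not_less[symmetric])
      have "{i. 0 < (y + t *\<^sub>R (u - y)) $ i} \<subseteq> {i. 0 < u $ i}"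
      proof (intro subsetI CollectI)
        fix i assume pos: "i \<in> {i. 0 < (y + t *\<^sub>R (u - y)) $ i}"
        show "0 < u $ i"
        proof (rule ccontr)
          assume "\<not> 0 < u $ i"
          then have "(1 - t) * y $ i \<le> 0" "t * u $ i \<le> 0"
            using le[of i] t by (auto intro!: mult_nonneg_nonpos)
          then show False
            using pos by (simp add: algebra_simps)
        qed
      qed
      then show "y + t *\<^sub>R (u - y) \<in> sparse_set s"
        using u by (intro sparse_setI) (auto simp: sparse_set_def l0_vpos)
    qed
  qed
qed

text \<open>
  In the decreasing list of the entries of \<open>y\<^sub>+\<close>, the positive ones form an initial segment, of
  length \<open>s\<close>. Its last element is therefore the smallest positive entry of \<open>y\<close>.
\<close>

lemma sth_largest_pos_bounds:
  fixes y :: "real^'m"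
  assumes y: "l0 (vpos y) = s" and s: "0 < s"
  shows "0 < sth_largest_pos s y" and "0 < y $ i \<Longrightarrow> sth_largest_pos s y \<le> y $ i"
proof -
  define X where "X = image_mset (\<lambda>i. vpos y $ i) (mset_set (UNIV :: 'm set))"
  define L where "L = rev (sorted_list_of_multiset X)"
  have sth: "sth_largest_pos s y = L ! (s - 1)"
    by (simp add: sth_largest_pos_def L_def X_def)
  have msetL: "mset L = X"
    by (simp add: L_def)
  have desc: "L ! j \<le> L ! i" if "i \<le> j" "j < length L" for i j
    using sorted_rev_nth_mono[of L i j] that by (simp add: L_def)
  have "card {k. k < length L \<and> 0 < L ! k} = size (filter_mset (\<lambda>x. 0 < x) X)"
    by (metis length_filter_conv_card msetL mset_filter size_mset)
  also have "\<dots> = card {i. 0 < y $ i}"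
    by (simp add: X_def filter_mset_image_mset vpos_def less_max_iff_disj)
  finally have card: "card {k. k < length L \<and> 0 < L ! k} = s"
    using y by (simp add: l0_vpos)
  have pos_iff: "0 < L ! k \<longleftrightarrow> k < s" if k: "k < length L" for k
  proof
    assume "0 < L ! k"
    then have "{..k} \<subseteq> {k. k < length L \<and> 0 < L ! k}"
      using desc k by force
    then have "card {..k} \<le> s"
      using card card_mono[of "{k. k < length L \<and> 0 < L ! k}" "{..k}"] by simp
    then show "k < s"
      by simp
  next
    assume "k < s"
    show "0 < L ! k"
    proof (rule ccontr)
      assume "\<not> 0 < L ! k"
      then have "{k. k < length L \<and> 0 < L ! k} \<subseteq> {..<k}"
        using desc by (force simp: not_le[symmetric])
      then have "s \<le> k"
        using card card_mono[of "{..<k}" "{k. k < length L \<and> 0 < L ! k}"] by simp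
      with \<open>k < s\<close> show False
        by simp
    qed
  qed
  have "s \<le> card {..<length L}"
    unfolding card[symmetric] by (rule card_mono) auto
  then have len: "s - 1 < length L"
    using s by simp
  then show "0 < sth_largest_pos s y"
    using pos_iff[OF len] s by (simp add: sth)
  show "sth_largest_pos s y \<le> y $ i" if "0 < y $ i"
  proof -
    have "y $ i = vpos y $ i"
      using that by (simp add: vpos_def)
    also have "vpos y $ i \<in> set L"
      by (simp add: set_mset_mset[symmetric] msetL X_def del: set_mset_mset)
    finally obtain k where k: "k < length L" "L ! k = y $ i"
      by (auto simp: in_set_conv_nth)
    then have "k \<le> s - 1"
      using pos_iff[of k] that by simp
    then show ?thesis
      using desc[of k "s - 1"] len k by (simp add: sth)
  qed
qed

section \<open>Row submatrices and the inverse of their Gram matrix\<close>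

lemma mat_one_on_mult: "mat_one_on J *v w = (\<chi> i. if i \<in> J then w $ i else 0)"
  by (auto simp: vec_eq_iff matrix_vector_mult_def mat_one_on_def if_distrib if_distribR
      cong: if_cong)

lemma transpose_mat_one_on: "transpose (mat_one_on J) = mat_one_on J"
  by (auto simp: vec_eq_iff transpose_def mat_one_on_def)

lemma mat_one_on_idem: "mat_one_on J ** mat_one_on J = mat_one_on J"
  by (simp add: matrix_eq matrix_vector_mul_assoc[symmetric] mat_one_on_mult vec_eq_iff)

lemma row_submatrix_eq: "row_submatrix A J = mat_one_on J ** A"
  by (auto simp: vec_eq_iff matrix_matrix_mult_def mat_one_on_def row_submatrix_def if_distrib if_distribR
      cong: if_cong)

text \<open>
  This makes vanishing outside \<open>J \<times> J\<close> a matrix equation, so that the defining conditions of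
  \<open>mat_inverse_on\<close> become purely algebraic.
\<close>

lemma matrix_eq_sandwich_iff:
  fixes N :: "real^'a^'a"
  shows "(\<forall>i j. i \<notin> J \<or> j \<notin> J \<longrightarrow> N $ i $ j = 0) \<longleftrightarrow> mat_one_on J ** N ** mat_one_on J = N"
proof -
  have *: "(mat_one_on J ** X) $ i $ j = (if i \<in> J then X $ i $ j else 0)" for X :: "real^'a^'a" and i j
    using arg_cong[OF row_submatrix_eq[of X J], of "\<lambda>Y. Y $ i $ j"]
    by (simp add: row_submatrix_def)
  have "(X ** mat_one_on J) $ i $ j = (if j \<in> J then X $ i $ j else 0)"
    for X :: "real^'a^'a" and i j
  proof -
    have "(X ** mat_one_on J) $ i $ j = transpose (X ** mat_one_on J) $ j $ i"
      by (simp add: transpose_def)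
    also have "\<dots> = (mat_one_on J ** transpose X) $ j $ i"
      by (simp only: matrix_transpose_mul transpose_mat_one_on)
    finally have "(X ** mat_one_on J) $ i $ j = (mat_one_on J ** transpose X) $ j $ i" .
    then show ?thesis
      by (simp add: * transpose_def)
  qed
  with * have "(mat_one_on J ** N ** mat_one_on J) $ i $ j =
      (if i \<in> J \<and> j \<in> J then N $ i $ j else 0)" for i j
    by simp
  then show ?thesis
    by (auto simp: vec_eq_iff)
qed

text \<open>
  The rows with index in \<open>J\<close> span the row space, whose dimension is \<open>card J\<close>. Hence they are distinct
  and linearly independent, and \<open>w\<close> is the coefficient vector of a vanishing linear combination.
\<close>

lemma full_row_rank_on_inj:
  assumes rank: "full_row_rank_on J A"
    and w: "w v* row_submatrix A J = 0" "\<And>i. i \<notin> J \<Longrightarrow> w $ i = 0"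
  shows "w = 0"
proof -
  let ?B = "row_submatrix A J"
  let ?R = "(\<lambda>i. row i ?B) ` J"
  have "rows ?B \<subseteq> span ?R"
  proof
    fix r assume "r \<in> rows ?B"
    then obtain i where i: "r = row i ?B"
      by (auto simp: rows_def)
    show "r \<in> span ?R"
    proof (cases "i \<in> J")
      case False
      then have "r = 0"
        by (simp add: i row_def row_submatrix_def vec_eq_iff)
      then show ?thesis
        by (simp add: span_zero)
    qed (simp add: i span_base)
  qed
  then have "dim (rows ?B) \<le> dim ?R"
    by (metis dim_span dim_subset span_minimal subspace_span)
  then have J: "card J \<le> dim ?R"
    using rank by (simp add: full_row_rank_on_def row_rank_def)
  have "dim ?R \<le> card ?R"
    by (rule dim_le_card') simp
  moreover have "card ?R \<le> card J"
    by (rule card_image_le) simp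
  ultimately have eq: "card ?R = card J" "card ?R \<le> dim ?R"
    using J by auto
  have inj: "inj_on (\<lambda>i. row i ?B) J"
    using eq(1) by (intro eq_card_imp_inj_on) auto
  have indep: "independent ?R"
    using eq(2) by (intro card_le_dim_spanning[of _ ?R]) (auto simp: span_base)
  have "w v* ?B = (\<Sum>i\<in>UNIV. w $ i *\<^sub>R row i ?B)"
    by (simp add: vec_eq_iff vector_matrix_mult_def row_def mult.commute)
  also have "\<dots> = (\<Sum>i\<in>J. w $ i *\<^sub>R row i ?B)"
    using w(2) by (intro sum.mono_neutral_right) auto
  also have "\<dots> = (\<Sum>r\<in>?R. w $ (the_inv_into J (\<lambda>i. row i ?B) r) *\<^sub>R r)"
    by (simp add: sum.reindex[OF inj] the_inv_into_f_f[OF inj])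
  finally have "(\<Sum>r\<in>?R. w $ (the_inv_into J (\<lambda>i. row i ?B) r) *\<^sub>R r) = 0"
    using w(1) by simp
  then have "w $ (the_inv_into J (\<lambda>i. row i ?B) r) = 0" if "r \<in> ?R" for r
    using independentD[OF indep _ subset_refl _ that] by simp
  then have "w $ i = 0" if "i \<in> J" for i
    using that the_inv_into_f_f[OF inj that] by fastforce
  then show ?thesis
    using w(2) by (auto simp: vec_eq_iff)
qed

text \<open>
  The Gram matrix \<open>G\<close>, extended by zero, is singular unless \<open>J\<close> is everything. Adding the identity on the
  complement of \<open>J\<close> gives the block matrix \<open>M = diag(G, 1)\<close>, which is invertible because
  \<open>x \<bullet> M x\<close> is a sum of two squares that vanish together only for \<open>x = 0\<close>. The \<open>J\<close>-block
  of its inverse is the wanted inverse of \<open>G\<close>, and associativity gives the uniqueness that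
  the definite description needs.
\<close>

lemma mat_inverse_on_gram:
  fixes A :: "real^'n^'m"
  assumes rank: "full_row_rank_on J A"
  defines "G \<equiv> row_submatrix A J ** transpose (row_submatrix A J)"
  shows "G ** mat_inverse_on J G = mat_one_on J"
    and "mat_inverse_on J G ** G = mat_one_on J"
    and "mat_one_on J ** mat_inverse_on J G = mat_inverse_on J G"
proof -
  let ?I = "mat_one_on J :: real^'m^'m" and ?B = "row_submatrix A J"
  have IB: "?I ** ?B = ?B"
    by (simp add: row_submatrix_eq matrix_mul_assoc mat_one_on_idem)
  have BI: "transpose ?B ** ?I = transpose ?B"
    using arg_cong[OF IB, of transpose] by (simp only: matrix_transpose_mul transpose_mat_one_on)
  have IG: "?I ** G = G" and GI: "G ** ?I = G"
    by (simp_all only: G_def matrix_mul_assoc IB) (simp only: BI flip: matrix_mul_assoc)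
  define M where "M = G + (mat 1 - ?I)"
  have "x = 0" if Mx: "M *v x = 0" for x
  proof -
    let ?z = "(mat 1 - ?I) *v x"
    have z: "?z = (\<chi> i. if i \<in> J then 0 else x $ i)"
      by (simp add: matrix_vector_mult_diff_rdistrib mat_one_on_mult vec_eq_iff)
    have "x \<bullet> (G *v x) = (norm (x v* ?B))\<^sup>2"
      by (simp add: G_def power2_norm_eq_inner dot_lmul_matrix flip: matrix_vector_mul_assoc)
    moreover have "x \<bullet> ?z = (norm ?z)\<^sup>2"
      by (auto simp: z power2_norm_eq_inner inner_vec_def intro!: sum.cong)
    moreover have "x \<bullet> (G *v x) + x \<bullet> ?z = 0"
      using Mx by (simp add: M_def matrix_vector_mult_add_rdistrib flip: inner_add_right)
    ultimately have "(norm (x v* ?B))\<^sup>2 + (norm ?z)\<^sup>2 = 0"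
      by simp
    then have "x v* ?B = 0" and "?z = 0"
      by (simp_all add: sum_power2_eq_zero_iff)
    have off: "x $ i = 0" if "i \<notin> J" for i
    proof -
      have "(\<chi> i. if i \<in> J then 0 else x $ i) $ i = (0 :: real^'m) $ i"
        using \<open>?z = 0\<close> unfolding z by (rule arg_cong)
      then show ?thesis
        using that by simp
    qed
    show "x = 0"
      using rank \<open>x v* ?B = 0\<close> off by (rule full_row_rank_on_inj)
  qed
  then obtain M' where M'1: "M' ** M = mat 1"
    using matrix_left_invertible_ker[of M] by auto
  then have M'2: "M ** M' = mat 1"
    by (simp only: matrix_left_right_inverse)
  have apply_idem: "?I *v (?I *v z) = ?I *v z" "?I *v (G *v z) = G *v z" "G *v (?I *v z) = G *v z"
    for z
    by (simp_all only: matrix_vector_mul_assoc mat_one_on_idem IG GI)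
  have IM: "?I ** M = G" and MI: "M ** ?I = G"
    by (simp_all add: matrix_eq M_def apply_idem matrix_vector_mult_add_rdistrib
        matrix_vector_mult_diff_rdistrib matrix_vector_right_distrib
        matrix_vector_mult_diff_distrib flip: matrix_vector_mul_assoc)
  have GM': "G ** M' = ?I" and M'G: "M' ** G = ?I"
    by (metis IM M'2 matrix_mul_assoc matrix_mul_rid)
       (metis MI M'1 matrix_mul_assoc matrix_mul_lid)
  define N where "N = ?I ** M' ** ?I"
  let ?inv = "\<lambda>N. ?I ** N ** ?I = N \<and> G ** N = ?I \<and> N ** G = ?I"
  have N: "?inv N"
  proof (intro conjI)
    show "?I ** N ** ?I = N"
      by (metis N_def mat_one_on_idem matrix_mul_assoc)
    show "G ** N = ?I"
      by (metis N_def GM' GI mat_one_on_idem matrix_mul_assoc)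
    show "N ** G = ?I"
      by (metis N_def M'G IG mat_one_on_idem matrix_mul_assoc)
  qed
  have unique: "N' = N" if N': "?inv N'" for N'
  proof -
    have "N' = N' ** ?I"
      by (metis N' mat_one_on_idem matrix_mul_assoc)
    also have "\<dots> = ?I ** N"
      by (metis N' N matrix_mul_assoc)
    also have "\<dots> = N"
      by (metis N mat_one_on_idem matrix_mul_assoc)
    finally show ?thesis .
  qed
  have inv: "?inv (mat_inverse_on J G)"
    unfolding mat_inverse_on_def matrix_eq_sandwich_iff
    using N unique by (rule theI)
  then show "G ** mat_inverse_on J G = mat_one_on J" "mat_inverse_on J G ** G = mat_one_on J"
    by auto
  show "?I ** mat_inverse_on J G = mat_inverse_on J G"
    using inv by (metis mat_one_on_idem matrix_mul_assoc)
qed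

section \<open>Multipliers of local minimizers\<close>

text \<open>
  For small steps the negative entries of \<open>A x - b\<close> stay negative, so new positive entries can
  only come from active rows along which \<open>d\<close> increases.
\<close>

lemma feasible_direction:
  assumes card: "card ({i. 0 < (A *v x - b) $ i} \<union> {i \<in> active_set A b x. 0 < (A *v d) $ i}) \<le> s"
  shows "eventually (\<lambda>t. x + t *\<^sub>R d \<in> feasible A b s) (at_right 0)"
proof -
  let ?y = "A *v x - b"
  have line: "A *v (x + t *\<^sub>R d) - b = ?y + t *\<^sub>R (A *v d)" for t
    by (simp add: matrix_vector_right_distrib matrix_vector_mult_scaleR)
  have "eventually (\<lambda>t. (?y + t *\<^sub>R (A *v d)) $ i < 0) (at_right 0)" if "?y $ i < 0" for i
  proof -
    have "((\<lambda>t. (?y + t *\<^sub>R (A *v d)) $ i) \<longlongrightarrow> (?y + 0 *\<^sub>R (A *v d)) $ i) (at_right 0)"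
      by (intro tendsto_intros)
    then show ?thesis
      using that by (intro order_tendstoD) auto
  qed
  then have "eventually (\<lambda>t. \<forall>i\<in>{i. ?y $ i < 0}. (?y + t *\<^sub>R (A *v d)) $ i < 0) (at_right 0)"
    by (intro eventually_ball_finite) auto
  then show ?thesis
    using eventually_at_right_less[of "0::real"]
  proof eventually_elim
    case (elim t)
    have "{i. 0 < (?y + t *\<^sub>R (A *v d)) $ i} \<subseteq>
        {i. 0 < ?y $ i} \<union> {i \<in> active_set A b x. 0 < (A *v d) $ i}" (is "_ \<subseteq> ?U")
    proof
      fix i assume i: "i \<in> {i. 0 < (?y + t *\<^sub>R (A *v d)) $ i}"
      consider "?y $ i < 0" | "?y $ i = 0" | "?y $ i > 0"
        by linarith
      then show "i \<in> ?U"
      proof cases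
        case 1
        then show ?thesis
          using elim(1) i by force
      next
        case 2
        then have "0 < t * (A *v d) $ i"
          using i by simp
        then show ?thesis
          using 2 elim(2) by (simp add: active_set_def zero_less_mult_iff)
      qed simp
    qed
    then show ?case
      using card by (simp add: feasible_iff line sparse_setI)
  qed
qed

text \<open>
  The vector \<open>- v\<close> is the multiplier of the local minimizer \<open>x\<close>. Each conclusion comes from one
  family of feasible directions \<open>d\<close>, distinguished by the value \<open>B d\<close> on the active rows \<open>B\<close>:
  \<open>0\<close> for the representation of the gradient, \<open>- e\<^sub>i\<close> for the sign, and \<open>e\<^sub>i\<close> for the
  vanishing of \<open>v\<close> below the sparsity bound.
\<close>

lemma local_minimizer_multiplier:
  fixes f :: "real^'n \<Rightarrow> real" and A :: "real^'n^'m"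
  assumes diff: "f differentiable (at x)"
    and min: "local_minimizer f (feasible A b s) x"
    and rank: "full_row_rank_on (active_set A b x) A"
  defines "v \<equiv> Pi_mat A (active_set A b x) *v gradient f x"
  shows "gradient f x = v v* A"
    and "i \<notin> active_set A b x \<Longrightarrow> v $ i = 0"
    and "v $ i \<le> 0"
    and "l0 (vpos (A *v x - b)) < s \<Longrightarrow> v = 0"
proof -
  let ?J = "active_set A b x" and ?y = "A *v x - b" and ?g = "gradient f x"
  let ?B = "row_submatrix A ?J" and ?I = "mat_one_on ?J :: real^'m^'m"
  let ?G = "?B ** transpose ?B"
  define N where "N = mat_inverse_on ?J ?G"
  note N = mat_inverse_on_gram[OF rank, folded N_def]
  have v: "v = N *v (?B *v ?g)"
    by (simp add: v_def Pi_mat_def N_def matrix_vector_mul_assoc)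
  have supp: "v $ i = 0" if "i \<notin> ?J" for i
  proof -
    have "v = ?I *v v"
      by (metis N(3) v matrix_vector_mul_assoc)
    then have "v $ i = (?I *v v) $ i"
      by (rule arg_cong)
    then show ?thesis
      using that by (simp add: mat_one_on_mult)
  qed
  then show "i \<notin> ?J \<Longrightarrow> v $ i = 0" .
  have B_comp: "(?B *v d) $ i = (if i \<in> ?J then (A *v d) $ i else 0)" for d i
    by (simp add: row_submatrix_eq mat_one_on_mult flip: matrix_vector_mul_assoc)
  have BB: "?B *v (z v* ?B) = ?G *v z" for z
    by (simp flip: matrix_vector_mul_assoc)
  have K: "card {i. 0 < ?y $ i} \<le> s"
    using min by (simp add: local_minimizer_def feasible_def l0_vpos)
  have dir: "0 \<le> ?g \<bullet> d" if "card ({i. 0 < ?y $ i} \<union> {i. 0 < (?B *v d) $ i}) \<le> s" for d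
  proof (rule gradient_nonneg_of_local_minimizer[OF diff min], rule feasible_direction)
    have "{i \<in> ?J. 0 < (A *v d) $ i} = {i. 0 < (?B *v d) $ i}"
      by (auto simp: B_comp)
    then show "card ({i. 0 < ?y $ i} \<union> {i \<in> ?J. 0 < (A *v d) $ i}) \<le> s"
      using that by simp
  qed
  \<comment> \<open>\<open>r\<close> is the part of the gradient orthogonal to the active rows. As \<open>- r\<close> leaves all active
    entries unchanged, it is a feasible direction, and its slope is \<open>- \<parallel>r\<parallel>\<^sup>2\<close>.\<close>
  define r where "r = ?g - v v* ?B"
  have "?B *v r = ?B *v ?g - ?G *v v"
    by (simp only: r_def matrix_vector_mult_diff_distrib BB)
  also have "?G *v v = ?I *v (?B *v ?g)"
    by (metis N(1) v matrix_vector_mul_assoc)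
  also have "?I *v (?B *v ?g) = ?B *v ?g"
    by (simp add: mat_one_on_mult B_comp vec_eq_iff)
  finally have Br: "?B *v r = 0"
    by simp
  have "r \<bullet> r = ?g \<bullet> r - v \<bullet> (?B *v r)"
    by (metis r_def inner_diff_left dot_lmul_matrix)
  also have "\<dots> = - (?g \<bullet> - r)"
    by (simp add: Br)
  also have "\<dots> \<le> 0"
  proof -
    have "?B *v (- r) = 0"
      using Br linear_neg[OF matrix_vector_mul_linear[of ?B], of r] by simp
    then show ?thesis
      using dir[of "- r"] K by simp
  qed
  finally have "r = 0"
    using inner_ge_zero[of r] inner_eq_zero_iff[of r] by linarith
  then have g: "?g = v v* ?B"
    by (simp add: r_def)
  also have "\<dots> = v v* A"
  proof -
    have "v $ i * ?B $ i $ j = v $ i * A $ i $ j" for i j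
      using supp[of i] by (simp add: row_submatrix_def)
    then show ?thesis
      unfolding vector_matrix_mult_def by (simp only: mult.commute)
  qed
  finally show "?g = v v* A" .
  have unit: "\<exists>d. ?B *v d = axis i c \<and> ?g \<bullet> d = v $ i * c" if "i \<in> ?J" for i c
  proof (intro exI conjI)
    \<comment> \<open>\<open>B\<^sup>T (B B\<^sup>T)^-1\<close> is a right inverse of \<open>B\<close>.\<close>
    let ?d = "(N *v axis i c) v* ?B"
    have "?B *v ?d = ?I *v axis i c"
      by (simp only: BB) (metis N(1) matrix_vector_mul_assoc)
    also have "\<dots> = axis i c"
      using that by (auto simp: mat_one_on_mult axis_def vec_eq_iff)
    finally show Bd: "?B *v ?d = axis i c" .
    show "?g \<bullet> ?d = v $ i * c"
      by (simp add: g dot_lmul_matrix Bd inner_axis del: vector_matrix_mult_def)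
  qed
  show nonpos: "v $ i \<le> 0" for i
  proof (cases "i \<in> ?J")
    case True
    then obtain d where d: "?B *v d = axis i (- 1)" "?g \<bullet> d = v $ i * (- 1)"
      using unit by blast
    have "{j. 0 < (?B *v d) $ j} = {}"
      unfolding d(1) by (auto simp: axis_def)
    then have "0 \<le> ?g \<bullet> d"
      using K by (intro dir) simp
    then show ?thesis
      using d(2) by simp
  qed (simp add: supp)
  show "v = 0" if less: "l0 (vpos ?y) < s"
  proof -
    have "0 \<le> v $ i" for i
    proof (cases "i \<in> ?J")
      case True
      then obtain d where d: "?B *v d = axis i 1" "?g \<bullet> d = v $ i * 1"
        using unit by blast
      have "{j. 0 < ?y $ j} \<union> {j. 0 < (?B *v d) $ j} = insert i {j. 0 < ?y $ j}"
        unfolding d(1) by (auto simp: axis_def)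
      then have "0 \<le> ?g \<bullet> d"
        using less by (intro dir) (simp add: l0_vpos card_insert_if)
      then show ?thesis
        using d(2) by simp
    qed (simp add: supp)
    with nonpos show ?thesis
      by (simp add: vec_eq_iff order_antisym)
  qed
qed

lemma tau_star_bound:
  fixes f :: "real^'n \<Rightarrow> real" and A :: "real^'n^'m"
  assumes y: "l0 (vpos (A *v x - b)) = s" and s: "0 < s"
  shows "0 < tau_star f A b s x"
    and "0 < \<tau> \<Longrightarrow> ereal \<tau> \<le> tau_star f A b s x \<Longrightarrow> i \<in> active_set A b x \<Longrightarrow>
      \<tau> * \<bar>(Pi_mat A (active_set A b x) *v gradient f x) $ i\<bar> \<le> sth_largest_pos s (A *v x - b)"
proof -
  let ?J = "active_set A b x" and ?\<theta> = "sth_largest_pos s (A *v x - b)"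
  define v where "v = Pi_mat A ?J *v gradient f x"
  define m where "m = Max ((\<lambda>i. \<bar>v $ i\<bar>) ` ?J)"
  have \<theta>: "0 < ?\<theta>"
    using y s by (rule sth_largest_pos_bounds)
  have tau: "tau_star f A b s x = (if \<forall>i\<in>?J. v $ i = 0 then \<infinity> else ereal (?\<theta> / m))"
    by (simp add: tau_star_def v_def m_def Let_def)
  have m: "\<bar>v $ i\<bar> \<le> m" if "i \<in> ?J" for i
    unfolding m_def using that by (intro Max_ge) auto
  have m_pos: "0 < m" if "\<not> (\<forall>i\<in>?J. v $ i = 0)"
    using that m by fastforce
  show "0 < tau_star f A b s x"
    using \<theta> m_pos by (auto simp: tau)
  show "\<tau> * \<bar>(Pi_mat A ?J *v gradient f x) $ i\<bar> \<le> ?\<theta>"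
    if \<tau>: "0 < \<tau>" "ereal \<tau> \<le> tau_star f A b s x" and i: "i \<in> ?J"
  proof (cases "\<forall>i\<in>?J. v $ i = 0")
    case True
    then show ?thesis
      using i \<theta> by (simp add: v_def)
  next
    case False
    then have "\<tau> \<le> ?\<theta> / m"
      using \<tau>(2) unfolding tau if_not_P[OF False] by simp
    then have "\<tau> * m \<le> ?\<theta>"
      using m_pos[OF False] by (simp add: field_simps)
    moreover have "\<tau> * \<bar>v $ i\<bar> \<le> \<tau> * m"
      using m[OF i] \<tau>(1) by simp
    ultimately show ?thesis
      by (simp add: v_def)
  qed
qed

section \<open>Stationary points and minimizers\<close>

text \<open>
  Both cases of the necessary condition at once: the bound on \<open>\<tau>\<close> is only called for when the
  sparsity constraint is tight.
\<close>

lemma tau_stationary_of_local_minimizer: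
  fixes f :: "real^'n \<Rightarrow> real" and A :: "real^'n^'m"
  assumes diff: "f differentiable (at x)" and s: "0 < s"
    and min: "local_minimizer f (feasible A b s) x"
    and rank: "full_row_rank_on (active_set A b x) A"
    and \<tau>: "0 < \<tau>"
    and bound: "l0 (vpos (A *v x - b)) = s \<Longrightarrow> ereal \<tau> \<le> tau_star f A b s x"
  shows "tau_stationary f A b s \<tau> x"
proof -
  let ?y = "A *v x - b" and ?J = "active_set A b x"
  define v where "v = Pi_mat A ?J *v gradient f x"
  note v = local_minimizer_multiplier[OF diff min rank, folded v_def]
  have feas: "?y \<in> sparse_set s"
    using min by (simp add: local_minimizer_def feasible_iff)
  have "?y \<in> proj_set (sparse_set s) (?y + \<tau> *\<^sub>R (- v))"
  proof (cases "l0 (vpos ?y) < s")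
    case True
    then have "v = 0"
      by (rule v(4))
    then show ?thesis
      using feas proj_set_iff[of ?y "sparse_set s" 0] by simp
  next
    case False
    then have y: "l0 (vpos ?y) = s"
      using feas by (simp add: sparse_set_def)
    note \<theta> = sth_largest_pos_bounds[OF y s]
    have le: "\<tau> * - v $ i \<le> sth_largest_pos s ?y" for i
    proof (cases "i \<in> ?J")
      case True
      have "\<tau> * - v $ i = \<tau> * \<bar>v $ i\<bar>"
        using v(3)[of i] by simp
      also have "\<dots> \<le> sth_largest_pos s ?y"
        unfolding v_def using tau_star_bound(2)[OF y s \<tau> bound[OF y] True] .
      finally show ?thesis .
    qed (use v(2) \<theta>(1) in simp)
    show ?thesis
    proof (rule proj_set_sparse_setI[where \<theta> = "sth_largest_pos s ?y"])
      show "card {i. 0 < ?y $ i} = s"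
        using y by (simp add: l0_vpos)
      show "(\<tau> *\<^sub>R - v) $ i = 0" if "?y $ i \<noteq> 0" for i
        using that v(2)[of i] by (simp add: active_set_def)
      show "0 \<le> (\<tau> *\<^sub>R - v) $ i" for i
        using v(3)[of i] \<tau> by (simp add: mult_nonneg_nonpos)
    qed (use \<theta> le in \<open>auto intro: less_imp_le\<close>)
  qed
  moreover have "gradient f x + transpose A *v (- v) = 0"
    using v(1) by (simp add: vector_matrix_mult_def vec_eq_iff sum_negf)
  ultimately show ?thesis
    using \<tau> unfolding tau_stationary_def by blast
qed

lemma tau_stationaryE:
  assumes "tau_stationary f A b s \<tau> x"
  obtains l where "0 < \<tau>" "\<And>z. gradient f x \<bullet> (z - x) = - (l \<bullet> ((A *v z - b) - (A *v x - b)))"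
    "gradient f x = - (l v* A)"
    "A *v x - b \<in> proj_set (sparse_set s) (A *v x - b + \<tau> *\<^sub>R l)"
proof -
  obtain l where l: "0 < \<tau>" "gradient f x + transpose A *v l = 0"
      "A *v x - b \<in> proj_set (sparse_set s) (A *v x - b + \<tau> *\<^sub>R l)"
    using assms unfolding tau_stationary_def by blast
  have g: "gradient f x = - (l v* A)"
    using l(2) by (simp add: add_eq_0_iff2)
  have "gradient f x \<bullet> (z - x) = - (l \<bullet> ((A *v z - b) - (A *v x - b)))" for z
    by (simp add: g dot_lmul_matrix matrix_vector_mult_diff_distrib)
  then show thesis
    using that l g by blast
qed

lemma local_minimizer_of_tau_stationary:
  fixes f :: "real^'n \<Rightarrow> real"
  assumes diff: "f differentiable (at x)" and conv: "convex_on UNIV f"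
    and stat: "tau_stationary f A b s \<tau> x" and y: "l0 (vpos (A *v x - b)) = s"
  shows "local_minimizer f (feasible A b s) x"
proof -
  let ?y = "A *v x - b"
  obtain l where \<tau>: "0 < \<tau>"
    and g: "\<And>z. gradient f x \<bullet> (z - x) = - (l \<bullet> ((A *v z - b) - ?y))"
    and proj: "?y \<in> proj_set (sparse_set s) (?y + \<tau> *\<^sub>R l)"
    using tau_stationaryE[OF stat] by metis
  have "((\<lambda>z. A *v z - b) \<longlongrightarrow> ?y) (nhds x)"
    by (intro tendsto_intros filterlim_ident
        bounded_linear.tendsto[OF matrix_vector_mul_bounded_linear])
  then have "eventually (\<lambda>z. A *v z - b \<in> sparse_set s \<longrightarrow> (\<forall>t. 0 < t \<longrightarrow> t \<le> 1 \<longrightarrow>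
      ?y + t *\<^sub>R (A *v z - b - ?y) \<in> sparse_set s)) (nhds x)"
    using sparse_set_locally_star_shaped[OF y]
    by (rule eventually_compose_filterlim[rotated])
  then obtain e where e: "e > 0"
    and star: "\<And>z t. dist z x < e \<Longrightarrow> A *v z - b \<in> sparse_set s \<Longrightarrow> 0 < t \<Longrightarrow> t \<le> 1 \<Longrightarrow>
      ?y + t *\<^sub>R (A *v z - b - ?y) \<in> sparse_set s"
    unfolding eventually_nhds_metric by blast
  have "f x \<le> f z" if z: "z \<in> feasible A b s" "z \<in> ball x e" for z
  proof -
    have "(\<tau> *\<^sub>R l) \<bullet> (A *v z - b - ?y) \<le> 0"
      using proj z star[of z]
      by (intro inner_nonpos_of_proj_set) (auto simp: feasible_iff dist_commute)
    then have "0 \<le> gradient f x \<bullet> (z - x)"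
      using \<tau> by (simp add: g mult_le_0_iff)
    then show ?thesis
      using convex_on_above_tangent[OF diff conv, of z] by simp
  qed
  then show ?thesis
    using e y by (auto simp: local_minimizer_def feasible_def)
qed

lemma global_minimizer_of_tau_stationary:
  fixes f :: "real^'n \<Rightarrow> real"
  assumes diff: "f differentiable (at x)" and conv: "convex_on UNIV f"
    and stat: "tau_stationary f A b s \<tau> x" and less: "l0 (vpos (A *v x - b)) < s"
  shows "global_minimizer f (feasible A b s) x"
proof -
  obtain l where "0 < \<tau>" and g: "gradient f x = - (l v* A)"
    and proj: "A *v x - b \<in> proj_set (sparse_set s) (A *v x - b + \<tau> *\<^sub>R l)"
    using tau_stationaryE[OF stat] by metis
  moreover have "\<tau> *\<^sub>R l = 0"
    using proj less by (rule eq_0_of_proj_set_sparse_set)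
  ultimately have "gradient f x = 0"
    by simp
  then have "f x \<le> f z" for z
    using convex_on_above_tangent[OF diff conv, of z] by simp
  then show ?thesis
    using less by (simp add: global_minimizer_def feasible_def)
qed

text \<open>
  The variational inequality of the projection is multiplied out without any limit here: its
  quadratic term is what the modulus \<open>M\<close> absorbs, and this is why the result is global even when
  the sparsity constraint is tight.
\<close>

lemma global_minimizer_of_tau_stationary_strongly_convex:
  fixes f :: "real^'n \<Rightarrow> real"
  assumes conv: "strongly_convex M f"
    and stat: "tau_stationary f A b s \<tau> x" and le: "(spectral_norm A)\<^sup>2 / M \<le> \<tau>"
  shows "global_minimizer f (feasible A b s) x"
proof -
  let ?y = "A *v x - b"
  obtain l where \<tau>: "0 < \<tau>"
    and g: "\<And>z. gradient f x \<bullet> (z - x) = - (l \<bullet> ((A *v z - b) - ?y))"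
    and proj: "?y \<in> proj_set (sparse_set s) (?y + \<tau> *\<^sub>R l)"
    using tau_stationaryE[OF stat] by metis
  have M: "0 < M"
    using conv by (simp add: strongly_convex_def)
  have "f x \<le> f z" if z: "z \<in> feasible A b s" for z
  proof -
    let ?q = "l \<bullet> ((A *v z - b) - ?y)"
    have "2 * \<tau> * ?q \<le> (norm ((A *v z - b) - ?y))\<^sup>2"
      using proj z unfolding proj_set_iff feasible_iff by (metis inner_scaleR_left mult.assoc)
    also have "(A *v z - b) - ?y = A *v (z - x)"
      by (simp add: matrix_vector_mult_diff_distrib)
    also have "(norm (A *v (z - x)))\<^sup>2 \<le> (spectral_norm A * norm (z - x))\<^sup>2"
      unfolding spectral_norm_def
      by (intro power_mono onorm matrix_vector_mul_bounded_linear norm_ge_zero)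
    also have "\<dots> \<le> (\<tau> * M) * (norm (z - x))\<^sup>2"
      using le M by (simp add: power_mult_distrib mult_right_mono pos_divide_le_eq)
    finally have "\<tau> * (2 * ?q) \<le> \<tau> * (M * (norm (z - x))\<^sup>2)"
      by (simp add: mult_ac matrix_vector_mult_diff_distrib)
    then have "2 * ?q \<le> M * (norm (z - x))\<^sup>2"
      using \<tau> by simp
    moreover have "f x + gradient f x \<bullet> (z - x) + M / 2 * (norm (z - x))\<^sup>2 \<le> f z"
      using conv by (simp add: strongly_convex_def)
    ultimately show ?thesis
      using g[of z] by simp
  qed
  then show ?thesis
    using proj by (simp add: global_minimizer_def feasible_iff proj_set_iff)
qed

theorem theorem3p3:
  fixes f :: "real^'n \<Rightarrow> real" and A :: "real^'n^'m" and b :: "real^'m"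
    and s :: nat and xs :: "real^'n"
  assumes diff: "\<And>x. f differentiable (at x)"
    and cont: "continuous_on UNIV (gradient f)"
    and dims: "CARD('m) \<le> CARD('n)"
    and s: "0 < s" "s < CARD('m)"
  shows
    "(local_minimizer f (feasible A b s) xs \<and> full_row_rank_on (active_set A b xs) A \<longrightarrow>
        (l0 (vpos (A *v xs - b)) < s \<longrightarrow> (\<forall>\<tau>>0. tau_stationary f A b s \<tau> xs)) \<and>
        (l0 (vpos (A *v xs - b)) = s \<longrightarrow>
           0 < tau_star f A b s xs \<and>
           (\<forall>\<tau>>0. ereal \<tau> \<le> tau_star f A b s xs \<longrightarrow> tau_stationary f A b s \<tau> xs)))
     \<and> (convex_on UNIV f \<and> (\<exists>\<tau>>0. tau_stationary f A b s \<tau> xs) \<longrightarrow>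
        (l0 (vpos (A *v xs - b)) = s \<longrightarrow> local_minimizer f (feasible A b s) xs) \<and>
        (l0 (vpos (A *v xs - b)) < s \<longrightarrow> global_minimizer f (feasible A b s) xs))
     \<and> (\<forall>M \<tau>. 0 < M \<and> strongly_convex M f \<and> 0 < \<tau> \<and> (spectral_norm A)\<^sup>2 / M \<le> \<tau> \<and>
        tau_stationary f A b s \<tau> xs \<longrightarrow> global_minimizer f (feasible A b s) xs)"
proof (intro conjI impI allI)
  assume min: "local_minimizer f (feasible A b s) xs \<and> full_row_rank_on (active_set A b xs) A"
  show "tau_stationary f A b s \<tau> xs" if "l0 (vpos (A *v xs - b)) < s" "0 < \<tau>" for \<tau>
    using that min by (intro tau_stationary_of_local_minimizer diff s(1)) auto
  show "0 < tau_star f A b s xs" if "l0 (vpos (A *v xs - b)) = s"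
    using that s(1) by (rule tau_star_bound)
  show "tau_stationary f A b s \<tau> xs" if "0 < \<tau>" "ereal \<tau> \<le> tau_star f A b s xs" for \<tau>
    using that min by (intro tau_stationary_of_local_minimizer diff s(1)) auto
next
  assume *: "convex_on UNIV f \<and> (\<exists>\<tau>>0. tau_stationary f A b s \<tau> xs)"
  show "local_minimizer f (feasible A b s) xs" if "l0 (vpos (A *v xs - b)) = s"
    using * that local_minimizer_of_tau_stationary[OF diff] by blast
  show "global_minimizer f (feasible A b s) xs" if "l0 (vpos (A *v xs - b)) < s"
    using * that global_minimizer_of_tau_stationary[OF diff] by blast
next
  fix M \<tau>
  assume "0 < M \<and> strongly_convex M f \<and> 0 < \<tau> \<and> (spectral_norm A)\<^sup>2 / M \<le> \<tau> \<and>
    tau_stationary f A b s \<tau> xs"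
  then show "global_minimizer f (feasible A b s) xs"
    using global_minimizer_of_tau_stationary_strongly_convex by blast
qed

end
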